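(* Let $(X,d_X)$ be a metric space and let $d$ be a metric on the double of $X$ with $d^*=d$. Then $[d^2]=[d]$ in $M(X)$ if and only if there exist $\alpha\ge 0$ and $\beta\ge 1$ such that $$-\alpha+\frac1\beta\, d(x,x')\le d(x,X')\quad\text{for all }x\in X.$$
   Context: Let $(X,d_X)$ be a metric space. Write $x$ for $(x,0)$ and $x'$ for $(x,1)$ in $X\times\{0,1\}$, and $X'=X\times\{1\}$. A metric on the double of $X$ is a metric $d$ on $X\times\{0,1\}$ whose restriction to each of the two copies of $X$ equals $d_X$ and for which $\inf_{x,y\in X}d(x,y')>0$; the set of these is $\mathcal M(X)$. Put $d(x,X')=\inf_{y\in X}d(x,y')$. Equivalence: $d_1\sim d_2$ if there exist $\alpha>0$, $\beta\ge 1$ with $-\alpha+\frac1\beta d_1(x,y')\le d_2(x,y')\le\alpha+\beta d_1(x,y')$ for all $x,y\in X$. $[d]$ is the class of $d$ and $M(X)=\mathcal M(X)/\sim$. Composition: $\rho d(x,z')=\inf_{y\in X}[d(x,y')+\rho(y,z')]$ defines $\rho d\in\mathcal M(X)$ for $\rho,d\in\mathcal M(X)$; $d^2=dd$. The adjoint $d^*\in\mathcal M(X)$ is defined by $d^*(x,y')=d(y,x')$. *)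

theory Defs
  imports "HOL-Analysis.Analysis"
begin

text \<open>The double of \<open>X\<close> is \<open>'a \<times> bool\<close>, where \<open>(x, False)\<close> is the point $x = (x,0)$ and
  \<open>(x, True)\<close> is the point $x' = (x,1)$.\<close>

type_synonym 'a double_dist = "'a \<times> bool \<Rightarrow> 'a \<times> bool \<Rightarrow> real"

abbreviation cross :: "'a double_dist \<Rightarrow> 'a \<Rightarrow> 'a \<Rightarrow> real" where
  "cross d x y \<equiv> d (x, False) (y, True)"

definition double_metrics :: "('a::metric_space) double_dist set" where
  "double_metrics = {d. Metric_space UNIV d
      \<and> (\<forall>x y i. d (x, i) (y, i) = dist x y)
      \<and> (INF (x, y)\<in>UNIV. cross d x y) > 0}"

definition dist_to_copy :: "'a double_dist \<Rightarrow> 'a \<Rightarrow> real" where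
  "dist_to_copy d x = (INF y. cross d x y)"

text \<open>A metric on the double is determined by its values $d(x,y')$; composition and adjoint are
  given by these values and extended by \<open>dist\<close> on each copy and by symmetry.\<close>

definition double_of :: "('a::metric_space \<Rightarrow> 'a \<Rightarrow> real) \<Rightarrow> 'a double_dist" where
  "double_of c = (\<lambda>(x, i) (y, j). if i = j then dist x y else if j then c x y else c y x)"

definition double_comp :: "('a::metric_space) double_dist \<Rightarrow> 'a double_dist \<Rightarrow> 'a double_dist" where
  "double_comp \<rho> d = double_of (\<lambda>x z. INF y. cross d x y + cross \<rho> y z)"

definition double_adjoint :: "('a::metric_space) double_dist \<Rightarrow> 'a double_dist" where
  "double_adjoint d = double_of (\<lambda>x y. cross d y x)"

definition double_equiv :: "(('a::metric_space) double_dist \<times> 'a double_dist) set" where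
  "double_equiv = {(d1, d2). d1 \<in> double_metrics \<and> d2 \<in> double_metrics \<and>
     (\<exists>\<alpha>>0. \<exists>\<beta>\<ge>1. \<forall>x y. - \<alpha> + 1 / \<beta> * cross d1 x y \<le> cross d2 x y
        \<and> cross d2 x y \<le> \<alpha> + \<beta> * cross d1 x y)}"

definition double_class :: "('a::metric_space) double_dist \<Rightarrow> 'a double_dist set" where
  "double_class d = double_equiv `` {d}"

definition double_quotient :: "('a::metric_space) double_dist set set" where
  "double_quotient = double_metrics // double_equiv"

lemma equiv_double_equiv:
  "equiv double_metrics (double_equiv :: (('a::metric_space) double_dist \<times> 'a double_dist) set)"
  (is "equiv _ ?R")
proof (rule equivI)
  show "?R \<subseteq> double_metrics \<times> double_metrics"
    by (auto simp: double_equiv_def)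
  show "refl_on double_metrics ?R"
    by (rule refl_onI) (auto simp: double_equiv_def intro!: exI[of _ "1::real"])
  show "sym ?R"
  proof (rule symI)
    fix d1 d2 :: "'a double_dist" assume "(d1, d2) \<in> double_equiv"
    then obtain a b where m: "d1 \<in> double_metrics" "d2 \<in> double_metrics" and ab: "a > 0" "b \<ge> 1"
      and le: "\<And>x y. - a + 1 / b * cross d1 x y \<le> cross d2 x y"
        "\<And>x y. cross d2 x y \<le> a + b * cross d1 x y"
      unfolding double_equiv_def by blast
    have "- (a * b) + 1 / b * cross d2 x y \<le> cross d1 x y"
      and "cross d1 x y \<le> a * b + b * cross d2 x y" for x y
    proof -
      have "cross d2 x y / b \<le> a / b + cross d1 x y"
        using le(2)[of x y] ab by (simp add: field_simps)
      moreover have "a / b \<le> a * b"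
        using ab mult_left_mono[of 1 "b * b" a] mult_mono[of 1 b 1 b] by (simp add: field_simps)
      ultimately show "- (a * b) + 1 / b * cross d2 x y \<le> cross d1 x y" by simp
      show "cross d1 x y \<le> a * b + b * cross d2 x y"
        using le(1)[of x y] ab by (simp add: field_simps)
    qed
    moreover have "a * b > 0" using ab by simp
    ultimately show "(d2, d1) \<in> double_equiv"
      using m ab unfolding double_equiv_def by blast
  qed
  show "trans ?R"
  proof (rule transI)
    fix d1 d2 d3 :: "'a double_dist"
    assume "(d1, d2) \<in> double_equiv" "(d2, d3) \<in> double_equiv"
    then obtain a b a' b' where m: "d1 \<in> double_metrics" "d3 \<in> double_metrics"
      and ab: "a > 0" "b \<ge> 1" "a' > 0" "b' \<ge> 1"
      and le: "\<And>x y. - a + 1 / b * cross d1 x y \<le> cross d2 x y"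
        "\<And>x y. cross d2 x y \<le> a + b * cross d1 x y"
        "\<And>x y. - a' + 1 / b' * cross d2 x y \<le> cross d3 x y"
        "\<And>x y. cross d3 x y \<le> a' + b' * cross d2 x y"
      unfolding double_equiv_def by blast
    have "- (a' + b' * a) + 1 / (b' * b) * cross d1 x y \<le> cross d3 x y"
      and "cross d3 x y \<le> (a' + b' * a) + (b' * b) * cross d1 x y" for x y
    proof -
      have "(- a + 1 / b * cross d1 x y) / b' \<le> cross d2 x y / b'"
        using le(1)[of x y] ab by (intro divide_right_mono) auto
      then have "- (a / b') + 1 / (b' * b) * cross d1 x y \<le> cross d2 x y / b'"
        by (simp add: diff_divide_distrib mult.commute)
      moreover have "a / b' \<le> b' * a"
        using ab mult_left_mono[of 1 "b' * b'" a] mult_mono[of 1 b' 1 b'] by (simp add: field_simps)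
      ultimately show "- (a' + b' * a) + 1 / (b' * b) * cross d1 x y \<le> cross d3 x y"
        using le(3)[of x y] by simp
      have "b' * cross d2 x y \<le> b' * (a + b * cross d1 x y)"
        using le(2)[of x y] ab by (intro mult_left_mono) auto
      then show "cross d3 x y \<le> (a' + b' * a) + (b' * b) * cross d1 x y"
        using le(4)[of x y] by (simp add: algebra_simps)
    qed
    moreover have "a' + b' * a > 0" using ab by (simp add: add_pos_pos)
    moreover have "b' * b \<ge> 1" using ab mult_mono[of 1 b' 1 b] by simp
    ultimately show "(d1, d3) \<in> double_equiv"
      using m unfolding double_equiv_def by blast
  qed
qed

lemma double_class_in_quotient: "d \<in> double_metrics \<Longrightarrow> double_class d \<in> double_quotient"
  by (simp add: double_class_def double_quotient_def quotientI)

lemma double_metricsI: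
  fixes c :: "'a::metric_space \<Rightarrow> 'a \<Rightarrow> real"
  assumes e: "e > 0" "\<And>x y. e \<le> c x y"
    and t1: "\<And>x y z. c x z \<le> dist x y + c y z"
    and t2: "\<And>x y z. c x z \<le> c x y + dist y z"
    and t3: "\<And>x y z. dist x z \<le> c x y + c z y"
    and t4: "\<And>x y z. dist x z \<le> c y x + c y z"
  shows "double_of c \<in> double_metrics"
proof -
  have nz: "0 < c x y" for x y using e by (meson less_le_trans)
  have "Metric_space UNIV (double_of c)"
  proof
    fix p q r :: "'a \<times> bool"
    show "0 \<le> double_of c p q"
      by (cases p; cases q) (auto simp: double_of_def less_imp_le[OF nz])
    show "double_of c p q = double_of c q p"
      by (cases p; cases q) (auto simp: double_of_def dist_commute)
    show "double_of c p q = 0 \<longleftrightarrow> p = q"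
      using nz by (cases p; cases q) (auto simp: double_of_def less_imp_neq[OF nz, symmetric])
    obtain x i y j z k where p: "p = (x, i)" "q = (y, j)" "r = (z, k)"
      by (cases p; cases q; cases r)
    show "double_of c p r \<le> double_of c p q + double_of c q r"
      using t1[of x z y] t2[of x z y] t3[of x z y] t4[of x z y]
        t1[of z x y] t2[of z x y] dist_triangle[of x z y]
      by (cases i; cases j; cases k) (simp_all add: p double_of_def dist_commute)
  qed
  moreover have "(INF (x, y)\<in>UNIV. cross (double_of c) x y) \<ge> e"
    by (rule cINF_greatest) (auto simp: double_of_def e)
  ultimately show ?thesis
    using e(1) by (auto simp: double_metrics_def double_of_def)
qed

lemma double_metrics_bounds:
  assumes "d \<in> double_metrics"
  obtains e where "e > 0" "\<And>x y. e \<le> cross d x y"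
    "\<And>x y z. cross d x z \<le> dist x y + cross d y z"
    "\<And>x y z. cross d x z \<le> cross d x y + dist y z"
    "\<And>x y z. dist x z \<le> cross d x y + cross d z y"
    "\<And>x y z. dist x z \<le> cross d y x + cross d y z"
proof -
  interpret Metric_space UNIV d using assms by (simp add: double_metrics_def)
  have eq: "d (x, i) (y, i) = dist x y" for x y i using assms by (simp add: double_metrics_def)
  let ?e = "INF (x, y)\<in>UNIV. cross d x y"
  have "?e \<le> cross d x y" for x y
  proof -
    have "bdd_below (range (\<lambda>(x, y). cross d x y))"
      by (auto intro!: bdd_belowI2[of _ 0])
    then show ?thesis
      using cINF_lower[of "\<lambda>(x, y). cross d x y" UNIV "(x, y)"] by simp
  qed
  moreover have "?e > 0" using assms by (simp add: double_metrics_def)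
  moreover have tri: "d p r \<le> d p q + d q r" for p q r by (simp add: triangle)
  have "cross d x z \<le> dist x y + cross d y z" "cross d x z \<le> cross d x y + dist y z"
    "dist x z \<le> cross d x y + cross d z y" "dist x z \<le> cross d y x + cross d y z" for x y z
    using tri[of "(x, False)" "(z, True)" "(y, False)"] tri[of "(x, False)" "(z, True)" "(y, True)"]
      tri[of "(x, False)" "(z, False)" "(y, True)"] tri[of "(x, True)" "(z, True)" "(y, False)"]
      commute[of "(y, True)" "(z, False)"] commute[of "(x, True)" "(y, False)"]
    by (simp_all add: eq)
  ultimately show ?thesis by (intro that[of ?e])
qed

lemma double_adjoint_in: "d \<in> double_metrics \<Longrightarrow> double_adjoint d \<in> double_metrics"
  unfolding double_adjoint_def
  by (erule double_metrics_bounds, rule double_metricsI, assumption)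
    (metis add.commute dist_commute)+

lemma double_comp_in:
  assumes "\<rho> \<in> double_metrics" "d \<in> double_metrics"
  shows "double_comp \<rho> d \<in> double_metrics"
proof -
  obtain e where d: "e > 0" "\<And>x y. e \<le> cross d x y"
    "\<And>x y z. cross d x z \<le> dist x y + cross d y z"
    "\<And>x y z. cross d x z \<le> cross d x y + dist y z"
    "\<And>x y z. dist x z \<le> cross d x y + cross d z y"
    "\<And>x y z. dist x z \<le> cross d y x + cross d y z"
    by (rule double_metrics_bounds[OF assms(2)]) (rule that)
  obtain e' where r: "e' > 0" "\<And>x y. e' \<le> cross \<rho> x y"
    "\<And>x y z. cross \<rho> x z \<le> dist x y + cross \<rho> y z"
    "\<And>x y z. cross \<rho> x z \<le> cross \<rho> x y + dist y z"
    "\<And>x y z. dist x z \<le> cross \<rho> x y + cross \<rho> z y"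
    "\<And>x y z. dist x z \<le> cross \<rho> y x + cross \<rho> y z"
    by (rule double_metrics_bounds[OF assms(1)]) (rule that)
  define c where "c = (\<lambda>x z. INF y. cross d x y + cross \<rho> y z)"
  have low: "c x z \<le> cross d x y + cross \<rho> y z" for x y z
    unfolding c_def by (rule cINF_lower)
      (auto intro!: bdd_belowI2[of _ "e + e'"] add_mono d r)
  have gr: "m \<le> c x z" if "\<And>y. m \<le> cross d x y + cross \<rho> y z" for m x z
    unfolding c_def using that by (intro cINF_greatest) auto
  have gr2: "m \<le> c x y + c z w"
    if h: "\<And>u v. m \<le> cross d x u + cross \<rho> u y + (cross d z v + cross \<rho> v w)" for m x y z w
  proof -
    have "m - (cross d z v + cross \<rho> v w) \<le> c x y" for v
      by (rule gr) (use h[of _ v] in \<open>simp add: algebra_simps\<close>)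
    then have "m - c x y \<le> c z w" by (intro gr) (simp add: algebra_simps)
    then show ?thesis by simp
  qed
  have "double_of c \<in> double_metrics"
  proof (rule double_metricsI[of "e + e'"])
    fix x y z
    show "e + e' > 0" using d(1) r(1) by simp
    show "e + e' \<le> c x y" by (intro gr add_mono d r)
    have "c x z - dist x y \<le> c y z"
    proof (rule gr)
      fix u show "c x z - dist x y \<le> cross d y u + cross \<rho> u z"
        using low[of x z u] d(3)[of x u y] by linarith
    qed
    then show "c x z \<le> dist x y + c y z" by simp
    have "c x z - dist y z \<le> c x y"
    proof (rule gr)
      fix u show "c x z - dist y z \<le> cross d x u + cross \<rho> u y"
        using low[of x z u] r(4)[of u z y] by linarith
    qed
    then show "c x z \<le> c x y + dist y z" by simp
    show "dist x z \<le> c x y + c z y"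
    proof (rule gr2)
      fix u v show "dist x z \<le> cross d x u + cross \<rho> u y + (cross d z v + cross \<rho> v y)"
        using d(5)[of x z u] d(4)[of z u v] r(5)[of u v y] dist_commute[of u v] by linarith
    qed
    show "dist x z \<le> c y x + c y z"
    proof (rule gr2)
      fix u v show "dist x z \<le> cross d y u + cross \<rho> u x + (cross d y v + cross \<rho> v z)"
        using r(6)[of x z u] r(3)[of u z v] d(6)[of u v y] by linarith
    qed
  qed
  then show ?thesis by (simp add: double_comp_def c_def)
qed

end

theory Submission
  imports Defs
begin

text \<open>For self-adjoint \<open>d\<close> the diagonal of \<open>d\<^sup>2\<close> is $d^2(x,x') = 2 d(x,X')$, so comparing \<open>d\<close> with
  \<open>d\<^sup>2\<close> on the diagonal gives the inequality. Conversely, the inequality bounds $d(x,x')$ linearly by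
  $d(x,y')$ for every \<open>y\<close>; then $d^2(x,z') \le d(x,x') + d(x,z')$ and
  $d(x,z') \le d(x,x') + d_X(x,z) \le d(x,x') + d(x,y') + d(y,z')$ give both halves of the
  equivalence.\<close>

text \<open>Both summands are nonnegative, so the infimum over intermediate points is bounded below
  and any single \<open>y\<close> gives an upper bound.\<close>

lemma cross_double_comp_le:
  assumes "\<rho> \<in> double_metrics" "d \<in> double_metrics"
  shows "cross (double_comp \<rho> d) x z \<le> cross d x y + cross \<rho> y z"
proof -
  interpret d: Metric_space UNIV d using assms(2) by (simp add: double_metrics_def)
  interpret \<rho>: Metric_space UNIV \<rho> using assms(1) by (simp add: double_metrics_def)
  show ?thesis
    by (auto simp: double_comp_def double_of_def intro!: cINF_lower bdd_belowI2[of _ 0])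
qed

lemma cross_double_comp_greatest:
  assumes "\<And>y. m \<le> cross d x y + cross \<rho> y z"
  shows "m \<le> cross (double_comp \<rho> d) x z"
  using assms by (auto simp: double_comp_def double_of_def intro!: cINF_greatest)

lemma dist_to_copy_le:
  assumes "d \<in> double_metrics"
  shows "dist_to_copy d x \<le> cross d x y"
proof -
  interpret Metric_space UNIV d using assms by (simp add: double_metrics_def)
  show ?thesis
    by (auto simp: dist_to_copy_def intro!: cINF_lower bdd_belowI2[of _ 0])
qed

lemma dist_to_copy_greatest:
  "(\<And>y. m \<le> cross d x y) \<Longrightarrow> m \<le> dist_to_copy d x"
  by (auto simp: dist_to_copy_def intro!: cINF_greatest)

lemma cross_commute_of_self_adjoint:
  assumes "double_adjoint d = d"
  shows "cross d x y = cross d y x"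
proof -
  have "cross (double_adjoint d) x y = cross d y x"
    by (simp add: double_adjoint_def double_of_def)
  then show ?thesis by (simp add: assms)
qed

lemma double_class_eq_iff:
  assumes "d1 \<in> double_metrics" "d2 \<in> double_metrics"
  shows "double_class d1 = double_class d2 \<longleftrightarrow> (d1, d2) \<in> double_equiv"
  unfolding double_class_def using eq_equiv_class_iff[OF equiv_double_equiv assms] .

lemma cross_le_of_equiv_square:
  assumes d: "d \<in> double_metrics" and sa: "double_adjoint d = d"
    and eq: "(d, double_comp d d) \<in> double_equiv"
  shows "\<exists>\<alpha>\<ge>0. \<exists>\<beta>\<ge>1. \<forall>x. - \<alpha> + 1 / \<beta> * cross d x x \<le> dist_to_copy d x"
proof -
  obtain a b where ab: "a > 0" "b \<ge> 1"
    and le: "\<And>x y. - a + 1 / b * cross d x y \<le> cross (double_comp d d) x y"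
    using eq unfolding double_equiv_def by blast
  \<comment> \<open>Both constants are halved because passing through y' and using self-adjointness
    gives d^2(x,x') \<le> 2 d(x,y').\<close>
  have "- (a / 2) + 1 / (2 * b) * cross d x x \<le> dist_to_copy d x" for x
  proof (rule dist_to_copy_greatest)
    fix y
    show "- (a / 2) + 1 / (2 * b) * cross d x x \<le> cross d x y"
      using le[of x x] cross_double_comp_le[OF d d, of x x y]
        cross_commute_of_self_adjoint[OF sa, of y x]
      by simp
  qed
  moreover have "a / 2 \<ge> 0" "2 * b \<ge> 1" using ab by auto
  ultimately show ?thesis by blast
qed

lemma equiv_square_of_cross_le:
  assumes d: "d \<in> double_metrics" and sa: "double_adjoint d = d"
    and ab: "\<alpha> \<ge> 0" "\<beta> \<ge> 1"
    and le: "\<And>x. - \<alpha> + 1 / \<beta> * cross d x x \<le> dist_to_copy d x"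
  shows "(d, double_comp d d) \<in> double_equiv"
proof -
  obtain e where tri1: "\<And>x y z. cross d x z \<le> cross d x y + dist y z"
    and tri2: "\<And>x y z. dist x z \<le> cross d x y + cross d z y"
    by (rule double_metrics_bounds[OF d]) (rule that)
  have diag: "cross d x x \<le> \<beta> * \<alpha> + \<beta> * cross d x y" for x y
  proof -
    have "cross d x x / \<beta> \<le> \<alpha> + cross d x y"
      using le[of x] dist_to_copy_le[OF d, of x y] by simp
    then show ?thesis using ab by (simp add: field_simps)
  qed
  have nn: "\<beta> * \<alpha> \<ge> 0" using ab by simp
  \<comment> \<open>The intermediate point is x itself, and \<open>diag\<close> is applied with y =
    z. The summand 1 keeps the additive constant positive, as \<open>double_equiv\<close> demands,
    even when \<alpha> = 0.\<close>
  have upper: "cross (double_comp d d) x z \<le> (\<beta> * \<alpha> + 1) + (\<beta> + 1) * cross d x z" for x z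
    using cross_double_comp_le[OF d d, of x z x] diag[of x z] by (simp add: algebra_simps)
  have lower: "- (\<beta> * \<alpha> + 1) + 1 / (\<beta> + 1) * cross d x z \<le> cross (double_comp d d) x z" for x z
  proof (rule cross_double_comp_greatest)
    fix y
    \<comment> \<open>The estimate below yields coefficient \<beta> + 1 at d(x,y') but only 1 at
      d(y,z'); this term raises the latter to \<beta> + 1.\<close>
    have dyz: "0 \<le> \<beta> * cross d y z"
      using d ab by (auto simp: double_metrics_def Metric_space_def)
    have "cross d x z \<le> \<beta> * \<alpha> + (\<beta> + 1) * (cross d x y + cross d y z)"
      using tri1[of x z x] tri2[of x z y] diag[of x y] dyz
        cross_commute_of_self_adjoint[OF sa, of y z]
      by (simp add: algebra_simps)
    \<comment> \<open>A crude enlargement: dividing by \<beta> + 1 then leaves the same additive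
      constant as in \<open>upper\<close>.\<close>
    also have "\<dots> \<le> (\<beta> + 1) * ((\<beta> * \<alpha> + 1) + (cross d x y + cross d y z))"
      using nn ab by (simp add: algebra_simps)
    finally have "cross d x z / (\<beta> + 1) \<le> (\<beta> * \<alpha> + 1) + (cross d x y + cross d y z)"
      using ab by (simp add: divide_le_eq mult.commute)
    then show "- (\<beta> * \<alpha> + 1) + 1 / (\<beta> + 1) * cross d x z \<le> cross d x y + cross d y z"
      by simp
  qed
  have "\<beta> * \<alpha> + 1 > 0" "\<beta> + 1 \<ge> 1" using nn ab by linarith+
  with upper lower d double_comp_in[OF d d] show ?thesis
    unfolding double_equiv_def by blast
qed

theorem theorem2p1:
  fixes d :: "('a::metric_space) double_dist"
  assumes "d \<in> double_metrics"
    and "double_adjoint d = d"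
  shows "double_class (double_comp d d) = double_class d \<longleftrightarrow>
    (\<exists>\<alpha>\<ge>0. \<exists>\<beta>\<ge>1. \<forall>x. - \<alpha> + 1 / \<beta> * cross d x x \<le> dist_to_copy d x)"
  \<comment> \<open>The equality of classes is read from right to left, so that the bounds on d^2
    are expressed through d.\<close>
  using cross_le_of_equiv_square[OF assms] equiv_square_of_cross_le[OF assms]
    double_class_eq_iff[OF assms(1) double_comp_in[OF assms(1) assms(1)]]
  by metis

end
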